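(* The generator $\mathcal L_n$ satisfies the following sector condition: there is a sequence of constants $(K_n)_{n\ge2}$, polynomial in $n$ (i.e. $K_n\le Cn^{\theta}$ for all $n\ge2$, for some constants $C,\theta>0$ independent of $n$), such that for all $n\ge 2$ and all smooth compactly supported functions $f,g:\Omega_n\to\mathbb R$, $$\langle f,-\mathcal L_ng\rangle_{\mu^n_{ss}}^2\le K_n\,\langle f,-\mathcal L_nf\rangle_{\mu^n_{ss}}\,\langle g,-\mathcal L_ng\rangle_{\mu^n_{ss}}.$$
   Context: Fix $\gamma\in(1,2)$ and $\Phi_\ell,\Phi_r\in\mathbb R$. For $n\ge2$ let $\Lambda_n=\{1,\dots,n-1\}$, $\Omega_n=\mathbb R^{\Lambda_n}$, $p(z)=c_\gamma\mathbf 1_{z\ne0}|z|^{-(1+\gamma)}$ with $c_\gamma=\big(\sum_{z\in\mathbb Z\setminus\{0\}}|z|^{-1-\gamma}\big)^{-1}$. $\mathcal L_n=n^\gamma(\mathcal L^\ell+\mathcal L^r+\mathcal L^{\rm bulk})$, where $\mathcal L^{\rm bulk}=\frac12\sum_{x,y\in\Lambda_n}p(y-x)\big[(\varphi(x)-\varphi(y))(\partial_{\varphi(y)}-\partial_{\varphi(x)})+(\partial_{\varphi(y)}-\partial_{\varphi(x)})^2\big]$, $\mathcal L^\ell=\partial^2_{\varphi(1)}+(\Phi_\ell-\varphi(1))\partial_{\varphi(1)}$, $\mathcal L^r=\partial^2_{\varphi(n-1)}+(\Phi_r-\varphi(n-1))\partial_{\varphi(n-1)}$. $\mu^n_{ss}$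 is the unique invariant probability measure of $\mathcal L_n$: the product over $x\in\Lambda_n$ of Gaussian laws $\mathcal N(\Phi^n_{ss}(x),1)$, where $\Phi^n_{ss}:\Lambda_n\to\mathbb R$ is the unique solution of $\sum_{y\in\Lambda_n}p(y-x)(\Phi^n_{ss}(y)-\Phi^n_{ss}(x))+\mathbf 1_{x=1}(\Phi_\ell-\Phi^n_{ss}(1))+\mathbf 1_{x=n-1}(\Phi_r-\Phi^n_{ss}(n-1))=0$ for all $x\in\Lambda_n$. $\langle\cdot,\cdot\rangle_{\mu^n_{ss}}$ is the $L^2(\mu^n_{ss})$ inner product. *)

theory Defs
  imports "HOL-Probability.Probability"
begin

definition sites :: "nat \<Rightarrow> nat set" where
  "sites n = {1..n - 1}"

text \<open>Configurations in \<open>\<real>\<^bsup>sites n\<^esup>\<close> are functions on \<^typ>\<open>nat\<close> that take the value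
  \<^const>\<open>undefined\<close> off \<open>sites n\<close>. The topology on this set induced by the product topology of
  \<^typ>\<open>nat \<Rightarrow> real\<close> is the Euclidean one. A function on configurations is a total function
  whose values outside \<open>configs n\<close> are never used.\<close>

definition configs :: "nat \<Rightarrow> (nat \<Rightarrow> real) set" where
  "configs n = sites n \<rightarrow>\<^sub>E UNIV"

definition c_norm :: "real \<Rightarrow> real" where
  "c_norm \<gamma> = inverse (\<Sum>\<^sub>\<infinity>z\<in>UNIV - {0::int}. \<bar>real_of_int z\<bar> powr (- 1 - \<gamma>))"

definition jump :: "real \<Rightarrow> int \<Rightarrow> real" where
  "jump \<gamma> z = (if z \<noteq> 0 then c_norm \<gamma> * \<bar>real_of_int z\<bar> powr (- (1 + \<gamma>)) else 0)"

definition pd :: "nat \<Rightarrow> ((nat \<Rightarrow> real) \<Rightarrow> real) \<Rightarrow> (nat \<Rightarrow> real) \<Rightarrow> real" where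
  "pd x f \<phi> = deriv (\<lambda>t. f (\<phi>(x := t))) (\<phi> x)"

text \<open>\<open>C_class k n f\<close>: all partial derivatives of \<open>f\<close> of order at most \<open>k\<close>, taken in any
  sequence of coordinates, exist and are continuous on \<open>configs n\<close>.\<close>

primrec C_class :: "nat \<Rightarrow> nat \<Rightarrow> ((nat \<Rightarrow> real) \<Rightarrow> real) \<Rightarrow> bool" where
  "C_class 0 n f \<longleftrightarrow> continuous_on (configs n) f"
| "C_class (Suc k) n f \<longleftrightarrow> continuous_on (configs n) f \<and>
     (\<forall>x\<in>sites n. (\<forall>\<phi>\<in>configs n. (\<lambda>t. f (\<phi>(x := t))) differentiable (at (\<phi> x)))
        \<and> C_class k n (pd x f))"

definition smooth_fun :: "nat \<Rightarrow> ((nat \<Rightarrow> real) \<Rightarrow> real) \<Rightarrow> bool" where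
  "smooth_fun n f \<longleftrightarrow> (\<forall>k. C_class k n f)"

definition compact_supp :: "nat \<Rightarrow> ((nat \<Rightarrow> real) \<Rightarrow> real) \<Rightarrow> bool" where
  "compact_supp n f \<longleftrightarrow> compact (closure {\<phi> \<in> configs n. f \<phi> \<noteq> 0})"

definition pdiff :: "nat \<Rightarrow> nat \<Rightarrow> ((nat \<Rightarrow> real) \<Rightarrow> real) \<Rightarrow> (nat \<Rightarrow> real) \<Rightarrow> real" where
  "pdiff x y f \<phi> = pd y f \<phi> - pd x f \<phi>"

definition gen_bulk :: "real \<Rightarrow> nat \<Rightarrow> ((nat \<Rightarrow> real) \<Rightarrow> real) \<Rightarrow> (nat \<Rightarrow> real) \<Rightarrow> real" where
  "gen_bulk \<gamma> n f \<phi> = 1 / 2 * (\<Sum>x\<in>sites n. \<Sum>y\<in>sites n. jump \<gamma> (int y - int x) *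
     ((\<phi> x - \<phi> y) * pdiff x y f \<phi> + pdiff x y (pdiff x y f) \<phi>))"

definition gen_res :: "real \<Rightarrow> nat \<Rightarrow> ((nat \<Rightarrow> real) \<Rightarrow> real) \<Rightarrow> (nat \<Rightarrow> real) \<Rightarrow> real" where
  "gen_res \<Phi> x f \<phi> = pd x (pd x f) \<phi> + (\<Phi> - \<phi> x) * pd x f \<phi>"

definition gen :: "real \<Rightarrow> real \<Rightarrow> real \<Rightarrow> nat \<Rightarrow> ((nat \<Rightarrow> real) \<Rightarrow> real) \<Rightarrow> (nat \<Rightarrow> real) \<Rightarrow> real" where
  "gen \<gamma> \<Phi>l \<Phi>r n f \<phi> = real n powr \<gamma> *
     (gen_res \<Phi>l 1 f \<phi> + gen_res \<Phi>r (n - 1) f \<phi> + gen_bulk \<gamma> n f \<phi>)"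

definition is_profile :: "real \<Rightarrow> real \<Rightarrow> real \<Rightarrow> nat \<Rightarrow> (nat \<Rightarrow> real) \<Rightarrow> bool" where
  "is_profile \<gamma> \<Phi>l \<Phi>r n \<Phi> \<longleftrightarrow> (\<forall>x\<in>sites n.
     (\<Sum>y\<in>sites n. jump \<gamma> (int y - int x) * (\<Phi> y - \<Phi> x))
     + (if x = 1 then \<Phi>l - \<Phi> 1 else 0)
     + (if x = n - 1 then \<Phi>r - \<Phi> (n - 1) else 0) = 0)"

text \<open>For \<open>n \<ge> 2\<close> the maximum principle makes the linear system injective, hence uniquely
  solvable on \<open>configs n\<close>.\<close>

definition profile :: "real \<Rightarrow> real \<Rightarrow> real \<Rightarrow> nat \<Rightarrow> nat \<Rightarrow> real" where
  "profile \<gamma> \<Phi>l \<Phi>r n = (THE \<Phi>. \<Phi> \<in> configs n \<and> is_profile \<gamma> \<Phi>l \<Phi>r n \<Phi>)"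

definition \<mu>ss :: "real \<Rightarrow> real \<Rightarrow> real \<Rightarrow> nat \<Rightarrow> (nat \<Rightarrow> real) measure" where
  "\<mu>ss \<gamma> \<Phi>l \<Phi>r n =
     (\<Pi>\<^sub>M x\<in>sites n. density lborel (\<lambda>t. ennreal (normal_density (profile \<gamma> \<Phi>l \<Phi>r n x) 1 t)))"

definition L2_inner :: "'a measure \<Rightarrow> ('a \<Rightarrow> real) \<Rightarrow> ('a \<Rightarrow> real) \<Rightarrow> real" where
  "L2_inner M f g = (\<integral>\<phi>. f \<phi> * g \<phi> \<partial>M)"

end

theory Submission
  imports Defs "Jordan_Normal_Form.Determinant"
begin

text \<open>The sector condition holds with \<open>K n = 1\<close>, because the generator is symmetric in
  \<open>L\<^sup>2\<close> of its stationary measure although the two reservoirs impose different values.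

  Let \<open>m\<close> be the stationary profile. Under the product of the laws \<open>N(m x, 1)\<close> the adjoint of
  the partial derivative in the coordinate \<open>x\<close> is \<open>u \<mapsto> (\<phi> x - m x) u - pd x u\<close> (lemma
  \<open>gaussian_by_parts\<close>). Written with these adjoints, each bond \<open>(x, y)\<close> of the bulk contributes,
  up to its rate, \<open>- X* X\<close>, where \<open>X = pd y - pd x\<close>, and a first-order remainder \<open>- (m y - m x) X\<close>; each
  reservoir contributes \<open>- (pd x)* pd x\<close> and a remainder \<open>(\<Phi> - m x) pd x\<close>. Summation by parts
  over the bonds turns the sum of all remainders into a vector field with constant coefficients,
  and its coefficient at \<open>x\<close> is exactly the left-hand side of the profile equation at \<open>x\<close>. So the
  remainders cancel (lemma \<open>gen_eq_adjoint_form\<close>).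

  Consequently \<open>\<langle>f, - L g\<rangle>\<close> is the integral of the carre du champ \<open>\<Gamma>(f, g)\<close>, a symmetric
  bilinear form in the gradients with nonnegative weights (lemma \<open>dirichlet_form\<close>), and the
  claim is the Cauchy-Schwarz inequality for this form.

  The argument uses that \<open>profile\<close>, a definite description, does solve its equation. The
  quadratic form of the linear system is a sum of squares which vanishes only at zero; so the
  system is injective, and being square it is uniquely solvable (lemma
  \<open>profile_is_profile\<close>).\<close>

section \<open>The stationary profile\<close>

lemma linear_system_solvable:
  fixes a :: "nat \<Rightarrow> nat \<Rightarrow> real"
  assumes inj: "\<And>u. (\<forall>i\<in>{1..d}. (\<Sum>j\<in>{1..d}. a i j * u j) = 0) \<Longrightarrow> \<forall>i\<in>{1..d}. u i = 0"
  shows "\<exists>u. \<forall>i\<in>{1..d}. (\<Sum>j\<in>{1..d}. a i j * u j) = b i"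
proof -
  define A where "A = Matrix.mat d d (\<lambda>(i, j). a (Suc i) (Suc j))"
  have A: "A \<in> carrier_mat d d" by (simp add: A_def)
  have sum_shift: "(\<Sum>j\<in>{1..d}. h j) = (\<Sum>j = 0..<d. h (Suc j))" for h :: "nat \<Rightarrow> real"
    by (simp add: sum.atLeast1_atMost_eq atLeast0LessThan)
  have mult: "vec_index (A *\<^sub>v v) i = (\<Sum>j\<in>{1..d}. a (Suc i) j * vec_index v (j - 1))"
    if "v \<in> carrier_vec d" "i < d" for v i
    using that by (simp only: sum_shift) (simp add: A_def scalar_prod_def)
  have "Determinant.det A \<noteq> 0"
  proof
    assume "Determinant.det A = 0"
    then obtain v where v: "v \<in> carrier_vec d" "v \<noteq> 0\<^sub>v d" "A *\<^sub>v v = 0\<^sub>v d"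
      using det_0_iff_vec_prod_zero_field[OF A] by blast
    have "\<forall>i\<in>{1..d}. (\<Sum>j\<in>{1..d}. a i j * vec_index v (j - 1)) = 0"
    proof
      fix i assume i: "i \<in> {1..d}"
      then have "i - 1 < d" by auto
      then have "(\<Sum>j\<in>{1..d}. a (Suc (i - 1)) j * vec_index v (j - 1)) = 0"
        using mult[OF v(1), of "i - 1"] v(3) by simp
      then show "(\<Sum>j\<in>{1..d}. a i j * vec_index v (j - 1)) = 0" using i by simp
    qed
    from inj[OF this] have "vec_index v i = 0" if "i < d" for i
      using that by (auto dest: bspec[where x = "Suc i"])
    then have "v = 0\<^sub>v d" using v(1) by (intro eq_vecI) auto
    with v(2) show False ..
  qed
  then obtain B where B: "B \<in> carrier_mat d d" "A * B = 1\<^sub>m d"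
    using det_non_zero_imp_unit[OF A, where b = "()"] unfolding Units_def by (auto simp: ring_mat_def)
  define w where "w = B *\<^sub>v Matrix.vec d (\<lambda>i. b (Suc i))"
  have w: "w \<in> carrier_vec d" using B(1) by (simp add: w_def)
  have "A *\<^sub>v w = (A * B) *\<^sub>v Matrix.vec d (\<lambda>i. b (Suc i))"
    unfolding w_def using A B(1) by (subst assoc_mult_mat_vec[of _ d d _ d]) auto
  then have Aw: "A *\<^sub>v w = Matrix.vec d (\<lambda>i. b (Suc i))" by (simp add: B(2))
  show ?thesis
  proof (intro exI ballI)
    fix i assume i: "i \<in> {1..d}"
    then have "i - 1 < d" by auto
    then show "(\<Sum>j\<in>{1..d}. a i j * vec_index w (j - 1)) = b i"
      using i mult[OF w, of "i - 1"] Aw by simp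
  qed
qed

lemma finite_sites [simp]: "finite (sites n)"
  by (simp add: sites_def)

lemma jump_minus: "jump \<gamma> (- z) = jump \<gamma> z"
  by (simp add: jump_def)

lemma jump_sym: "jump \<gamma> (int y - int x) = jump \<gamma> (int x - int y)"
  using jump_minus[of \<gamma> "int x - int y"] by simp

text \<open>The infinite sum takes the value 0 on families that are not summable, and then \<open>c_norm\<close>
  and all jump rates would vanish. Summability is therefore the real content here.\<close>

lemma c_norm_pos:
  assumes "\<gamma> > 0"
  shows "c_norm \<gamma> > 0"
proof -
  let ?h = "\<lambda>z::int. \<bar>real_of_int z\<bar> powr (- 1 - \<gamma>)"
  have "summable (\<lambda>k. real k powr (- 1 - \<gamma>))"
    using assms by (simp add: summable_real_powr_iff)
  then have "(\<lambda>k. real k powr (- 1 - \<gamma>)) summable_on UNIV"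
    by (intro norm_summable_imp_summable_on) simp
  then have nat: "(\<lambda>k. real k powr (- 1 - \<gamma>)) summable_on {1..}"
    by (rule summable_on_subset_banach) simp
  have "?h summable_on int ` {1..}"
    using nat by (subst summable_on_reindex) (auto simp: o_def)
  moreover have "?h summable_on (\<lambda>k. - int k) ` {1..}"
    using nat by (subst summable_on_reindex) (auto simp: o_def inj_on_def)
  ultimately have "?h summable_on (int ` {1..} \<union> (\<lambda>k. - int k) ` {1..})"
    by (rule summable_on_Un_disjoint) auto
  also have "int ` {1..} \<union> (\<lambda>k. - int k) ` {1..} = UNIV - {0::int}"
  proof -
    have "z \<in> int ` {1..} \<union> (\<lambda>k. - int k) ` {1..}" if "z \<noteq> 0" for z
      using that
      by (cases "z > 0") (auto intro: image_eqI[of _ _ "nat z"] image_eqI[of _ _ "nat (- z)"])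
    then show ?thesis by auto
  qed
  finally have sm: "?h summable_on UNIV - {0}" .
  have "?h 1 = infsum ?h {1}" by simp
  also have "\<dots> \<le> infsum ?h (UNIV - {0})"
    by (intro infsum_mono_neutral sm) auto
  finally show ?thesis by (simp add: c_norm_def)
qed

lemma jump_pos: "\<gamma> > 0 \<Longrightarrow> z \<noteq> 0 \<Longrightarrow> jump \<gamma> z > 0"
  by (simp add: jump_def c_norm_pos)

lemma jump_nonneg: "\<gamma> > 0 \<Longrightarrow> jump \<gamma> z \<ge> 0"
  using jump_pos[of \<gamma> z] by (cases "z = 0") (auto simp: jump_def)

text \<open>With \<open>v = m\<close> this is the energy identity of the profile equation; with \<open>v\<close> a gradient it
  turns the drift of the bonds into a drift of the sites.\<close>

lemma symmetric_sum_by_parts: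
  fixes J :: "'a \<Rightarrow> 'a \<Rightarrow> real"
  assumes "\<And>x y. J x y = J y x"
  shows "(\<Sum>x\<in>S. \<Sum>y\<in>S. J x y * ((m y - m x) * (v y - v x)))
       = - 2 * (\<Sum>x\<in>S. (\<Sum>y\<in>S. J x y * (m y - m x)) * v x)"
proof -
  have "(\<Sum>x\<in>S. \<Sum>y\<in>S. J x y * (m y - m x) * v y) = (\<Sum>x\<in>S. \<Sum>y\<in>S. J y x * (m x - m y) * v x)"
    by (rule sum.swap)
  also have "\<dots> = - (\<Sum>x\<in>S. \<Sum>y\<in>S. J x y * (m y - m x) * v x)"
    unfolding sum_negf[symmetric] using assms
    by (intro sum.cong refl) (simp add: algebra_simps)
  finally have "(\<Sum>x\<in>S. \<Sum>y\<in>S. J x y * (m y - m x) * v y)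
      = - (\<Sum>x\<in>S. \<Sum>y\<in>S. J x y * (m y - m x) * v x)" .
  moreover have "J x y * ((m y - m x) * (v y - v x))
      = J x y * (m y - m x) * v y - J x y * (m y - m x) * v x" for x y
    by (simp add: algebra_simps)
  ultimately show ?thesis
    by (simp only: sum_subtractf sum_distrib_right)
qed

text \<open>The linear part of the profile equation: the generator, on the lattice, of the long-jump
  walk killed at the two boundary sites.\<close>

definition profile_op :: "real \<Rightarrow> nat \<Rightarrow> (nat \<Rightarrow> real) \<Rightarrow> nat \<Rightarrow> real" where
  "profile_op \<gamma> n u x = (\<Sum>y\<in>sites n. jump \<gamma> (int y - int x) * (u y - u x))
     - (if x = 1 then u x else 0) - (if x = n - 1 then u x else 0)"

lemma is_profile_iff:
  "is_profile \<gamma> \<Phi>l \<Phi>r n u \<longleftrightarrow> (\<forall>x\<in>sites n. profile_op \<gamma> n u x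
     = - (if x = 1 then \<Phi>l else 0) - (if x = n - 1 then \<Phi>r else 0))"
  unfolding is_profile_def profile_op_def by (intro ball_cong refl) (auto simp: algebra_simps)

text \<open>Pairing the equation with \<open>u\<close> shows that the sum of the weighted squares of the increments
  equals \<open>- 2 (u 1\<^sup>2 + u (n - 1)\<^sup>2)\<close>. Both sides vanish, hence \<open>u 1 = 0\<close>; and since every jump has
  a positive rate, every site is compared with the site 1 directly.\<close>

lemma profile_op_inj:
  assumes "\<gamma> > 0" "n \<ge> 2" and u: "\<forall>x\<in>sites n. profile_op \<gamma> n u x = 0"
  shows "\<forall>x\<in>sites n. u x = 0"
proof -
  let ?J = "\<lambda>x y. jump \<gamma> (int y - int x)"
  let ?E = "\<Sum>x\<in>sites n. \<Sum>y\<in>sites n. ?J x y * ((u y - u x) * (u y - u x))"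
  have mem: "1 \<in> sites n" "n - 1 \<in> sites n" using assms(2) by (auto simp: sites_def)
  have E: "?E = - 2 * (\<Sum>x\<in>sites n. (\<Sum>y\<in>sites n. ?J x y * (u y - u x)) * u x)"
    by (rule symmetric_sum_by_parts) (rule jump_sym)
  have "(\<Sum>x\<in>sites n. (\<Sum>y\<in>sites n. ?J x y * (u y - u x)) * u x)
      = (\<Sum>x\<in>sites n. (if x = 1 then u x * u x else 0) + (if x = n - 1 then u x * u x else 0))"
    using u by (intro sum.cong refl) (auto simp: profile_op_def algebra_simps)
  also have "\<dots> = u 1 * u 1 + u (n - 1) * u (n - 1)"
    using mem by (simp add: sum.distrib)
  finally have eq: "?E = - 2 * (u 1 * u 1 + u (n - 1) * u (n - 1))" using E by simp
  have pos: "?J x y * ((u y - u x) * (u y - u x)) \<ge> 0" for x y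
    using jump_nonneg[OF assms(1)] by simp
  then have E0: "?E \<ge> 0" by (intro sum_nonneg)
  have sq: "0 \<le> u 1 * u 1" "0 \<le> u (n - 1) * u (n - 1)" by simp_all
  have u1: "u 1 * u 1 = 0" using eq E0 sq by argo
  have "?E = 0" using eq E0 sq by argo
  then have z: "?J x y * ((u y - u x) * (u y - u x)) = 0" if "x \<in> sites n" "y \<in> sites n" for x y
    using that by (simp add: sum_nonneg_eq_0_iff pos sum_nonneg)
  show ?thesis
  proof
    fix x assume x: "x \<in> sites n"
    show "u x = 0"
    proof (cases "x = 1")
      case False
      then have "?J x 1 > 0" by (intro jump_pos assms) auto
      then show ?thesis using z[OF x mem(1)] u1 by auto
    qed (use u1 in auto)
  qed
qed

lemma profile_op_diff: "profile_op \<gamma> n (\<lambda>x. u x - v x) x = profile_op \<gamma> n u x - profile_op \<gamma> n v x"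
proof -
  have "(\<Sum>y\<in>sites n. jump \<gamma> (int y - int x) * ((u y - v y) - (u x - v x)))
      = (\<Sum>y\<in>sites n. jump \<gamma> (int y - int x) * (u y - u x))
      - (\<Sum>y\<in>sites n. jump \<gamma> (int y - int x) * (v y - v x))"
    unfolding sum_subtractf[symmetric] by (intro sum.cong refl) (simp add: algebra_simps)
  then show ?thesis unfolding profile_op_def by auto
qed

lemma profile_op_surj:
  assumes "\<gamma> > 0" "n \<ge> 2"
  shows "\<exists>u. \<forall>x\<in>sites n. profile_op \<gamma> n u x = b x"
proof -
  \<comment> \<open>the matrix of \<open>profile_op\<close>; the diagonal collects the total jump rate and the killing\<close>
  define a where "a x y = jump \<gamma> (int y - int x) - (if x = y then (\<Sum>z\<in>sites n. jump \<gamma> (int z - int x))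
     + (if x = 1 then 1 else 0) + (if x = n - 1 then 1 else 0) else 0)" for x y
  have a: "(\<Sum>y\<in>sites n. a x y * u y) = profile_op \<gamma> n u x" if "x \<in> sites n" for u x
  proof -
    have "(\<Sum>y\<in>sites n. a x y * u y) = (\<Sum>y\<in>sites n. jump \<gamma> (int y - int x) * u y)
       - (\<Sum>y\<in>sites n. if x = y then ((\<Sum>z\<in>sites n. jump \<gamma> (int z - int x))
     + (if x = 1 then 1 else 0) + (if x = n - 1 then 1 else 0)) * u y else 0)"
      unfolding sum_subtractf[symmetric] a_def by (intro sum.cong refl) (simp add: algebra_simps)
    also have "\<dots> = profile_op \<gamma> n u x"
      using that by (simp add: profile_op_def sum.delta' algebra_simps sum_subtractf sum_distrib_left
        sum_distrib_right)
    finally show ?thesis .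
  qed
  show ?thesis
    using linear_system_solvable[of "n - 1" a b] a profile_op_inj[OF assms]
    unfolding sites_def by simp
qed

lemma profile_is_profile:
  assumes "\<gamma> > 0" "n \<ge> 2"
  shows "is_profile \<gamma> \<Phi>l \<Phi>r n (profile \<gamma> \<Phi>l \<Phi>r n)"
proof -
  obtain u where u: "is_profile \<gamma> \<Phi>l \<Phi>r n u"
    unfolding is_profile_iff
    using profile_op_surj[OF assms,
      of "\<lambda>x. - (if x = 1 then \<Phi>l else 0) - (if x = n - 1 then \<Phi>r else 0)"] by auto
  have "profile_op \<gamma> n (restrict u (sites n)) x = profile_op \<gamma> n u x" if "x \<in> sites n" for x
    using that unfolding profile_op_def by (auto intro!: sum.cong)
  then have "restrict u (sites n) \<in> configs n \<and> is_profile \<gamma> \<Phi>l \<Phi>r n (restrict u (sites n))"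
    using u unfolding is_profile_iff configs_def by auto
  moreover have "v = w"
    if v: "v \<in> configs n" "is_profile \<gamma> \<Phi>l \<Phi>r n v" and w: "w \<in> configs n" "is_profile \<gamma> \<Phi>l \<Phi>r n w"
    for v w
  proof -
    have "\<forall>x\<in>sites n. profile_op \<gamma> n (\<lambda>x. v x - w x) x = 0"
      using v w by (simp add: is_profile_iff profile_op_diff)
    from profile_op_inj[OF assms this] show ?thesis
      using v(1) w(1) unfolding configs_def by (auto intro: PiE_ext)
  qed
  ultimately show ?thesis
    unfolding profile_def
    using theI'[of "\<lambda>\<Phi>. \<Phi> \<in> configs n \<and> is_profile \<gamma> \<Phi>l \<Phi>r n \<Phi>"] by blast
qed

section \<open>Coordinatewise calculus on configurations\<close>

lemma configs_upd: "\<phi> \<in> configs n \<Longrightarrow> x \<in> sites n \<Longrightarrow> \<phi>(x := t) \<in> configs n"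
  unfolding configs_def by (auto simp: PiE_iff extensional_def)

lemma continuous_on_coord: "continuous_on A (\<lambda>\<phi>::nat \<Rightarrow> real. \<phi> x)"
  by (rule continuous_on_subset[OF continuous_on_product_coordinates]) simp

lemma closed_configs: "closed (configs n)"
proof -
  have "configs n = (\<Inter>i\<in>- sites n. {\<phi>. \<phi> i = undefined})"
    unfolding configs_def by (auto simp: PiE_iff extensional_def)
  moreover have "closed {\<phi>::nat \<Rightarrow> real. \<phi> i = undefined}" for i
    by (intro closed_Collect_eq continuous_on_product_coordinates continuous_on_const)
  ultimately show ?thesis by (simp add: closed_INT)
qed

lemma continuous_upd: "continuous_on UNIV (\<lambda>t::real. (\<phi>::nat \<Rightarrow> real)(x := t))"
proof (rule continuous_on_coordinatewise_then_product)
  show "continuous_on UNIV (\<lambda>t. (\<phi>(x := t)) i)" for i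
    by (cases "i = x") simp_all
qed

lemma continuous_on_line:
  assumes "continuous_on (configs n) u" "\<phi> \<in> configs n" "x \<in> sites n"
  shows "continuous_on UNIV (\<lambda>t. u (\<phi>(x := t)))"
  using continuous_on_compose2[OF assms(1) continuous_upd, of \<phi> x] configs_upd[OF assms(2,3)] by blast

lemma C1_deriv:
  assumes "C_class (Suc k) n f" "\<phi> \<in> configs n" "x \<in> sites n"
  shows "((\<lambda>t. f (\<phi>(x := t))) has_real_derivative pd x f (\<phi>(x := s))) (at s)"
proof -
  have "\<forall>\<psi>\<in>configs n. (\<lambda>t. f (\<psi>(x := t))) differentiable (at (\<psi> x))"
    using assms by simp
  from bspec[OF this configs_upd[OF assms(2,3), of s]]
  have "(\<lambda>t. f ((\<phi>(x := s))(x := t))) differentiable (at ((\<phi>(x := s)) x))" .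
  then show ?thesis
    unfolding pd_def by (simp add: DERIV_deriv_iff_real_differentiable)
qed

lemma pd_eqI:
  assumes "((\<lambda>t. f (\<phi>(x := t))) has_real_derivative D) (at (\<phi> x))"
  shows "pd x f \<phi> = D"
  using assms unfolding pd_def by (rule DERIV_imp_deriv)

lemma C1_pd:
  assumes "C_class (Suc k) n f" "\<phi> \<in> configs n" "x \<in> sites n"
  shows "((\<lambda>t. f (\<phi>(x := t))) has_real_derivative pd x f \<phi>) (at (\<phi> x))"
  using C1_deriv[OF assms, of "\<phi> x"] by simp

lemma C_class_cont: "C_class k n f \<Longrightarrow> continuous_on (configs n) f"
  by (cases k) auto

lemma C_class_pd: "C_class (Suc k) n f \<Longrightarrow> x \<in> sites n \<Longrightarrow> C_class k n (pd x f)"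
  by simp

lemma C1_I:
  assumes "continuous_on (configs n) f"
    and d: "\<And>x \<phi>. x \<in> sites n \<Longrightarrow> \<phi> \<in> configs n \<Longrightarrow>
      ((\<lambda>t. f (\<phi>(x := t))) has_real_derivative D x \<phi>) (at (\<phi> x))"
    and c: "\<And>x. x \<in> sites n \<Longrightarrow> continuous_on (configs n) (D x)"
  shows "C_class 1 n f"
proof -
  have "continuous_on (configs n) (pd x f)" if x: "x \<in> sites n" for x
  proof (rule continuous_on_eq[OF c[OF x]])
    show "D x \<phi> = pd x f \<phi>" if "\<phi> \<in> configs n" for \<phi>
      using pd_eqI[where f = f, OF d[OF x that]] ..
  qed
  then show ?thesis using assms by (auto simp: real_differentiable_def)
qed

lemma C1_diff:
  assumes "C_class 1 n u" "C_class 1 n v"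
  shows "C_class 1 n (\<lambda>\<phi>. u \<phi> - v \<phi>)"
proof (rule C1_I[where D = "\<lambda>x \<phi>. pd x u \<phi> - pd x v \<phi>"])
  show "continuous_on (configs n) (\<lambda>\<phi>. u \<phi> - v \<phi>)"
    using assms by (intro continuous_on_diff) simp_all
  show "continuous_on (configs n) (\<lambda>\<phi>. pd x u \<phi> - pd x v \<phi>)" if "x \<in> sites n" for x
    using assms that by (intro continuous_on_diff) simp_all
  show "((\<lambda>t. u (\<phi>(x := t)) - v (\<phi>(x := t))) has_real_derivative pd x u \<phi> - pd x v \<phi>)
      (at (\<phi> x))" if "x \<in> sites n" "\<phi> \<in> configs n" for x \<phi>
    using DERIV_diff[OF C1_pd[of 0 n u \<phi> x] C1_pd[of 0 n v \<phi> x]] assms that by simp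
qed

lemma C1_mult:
  assumes "C_class 1 n u" "C_class 1 n v"
  shows "C_class 1 n (\<lambda>\<phi>. u \<phi> * v \<phi>)"
proof (rule C1_I[where D = "\<lambda>x \<phi>. pd x u \<phi> * v \<phi> + pd x v \<phi> * u \<phi>"])
  show "continuous_on (configs n) (\<lambda>\<phi>. u \<phi> * v \<phi>)"
    using assms by (intro continuous_on_mult) simp_all
  show "continuous_on (configs n) (\<lambda>\<phi>. pd x u \<phi> * v \<phi> + pd x v \<phi> * u \<phi>)" if "x \<in> sites n" for x
    using assms that by (intro continuous_on_add continuous_on_mult) simp_all
  show "((\<lambda>t. u (\<phi>(x := t)) * v (\<phi>(x := t))) has_real_derivative pd x u \<phi> * v \<phi> + pd x v \<phi> * u \<phi>)
      (at (\<phi> x))" if "x \<in> sites n" "\<phi> \<in> configs n" for x \<phi>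
    using DERIV_mult[OF C1_pd[of 0 n u \<phi> x] C1_pd[of 0 n v \<phi> x]] assms that by simp
qed

lemma pd_mult:
  assumes "C_class 1 n u" "C_class 1 n v" "\<phi> \<in> configs n" "x \<in> sites n"
  shows "pd x (\<lambda>\<phi>. u \<phi> * v \<phi>) \<phi> = pd x u \<phi> * v \<phi> + pd x v \<phi> * u \<phi>"
  using assms DERIV_mult[OF C1_pd[of 0 n u \<phi> x] C1_pd[of 0 n v \<phi> x]]
  by (intro pd_eqI) simp

text \<open>Partial derivatives inherit the support: a coordinate line through a point off the closed
  set \<open>K\<close> stays off \<open>K\<close> for a while.\<close>

lemma pd_outside:
  assumes "closed K" "\<And>\<phi>. \<phi> \<in> configs n - K \<Longrightarrow> f \<phi> = 0" "\<phi> \<in> configs n - K" "x \<in> sites n"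
  shows "pd x f \<phi> = 0"
proof -
  have "open ((\<lambda>t. \<phi>(x := t)) -` (- K))"
    using continuous_upd[of \<phi> x] assms(1) by (intro open_vimage) auto
  moreover have "\<phi> x \<in> (\<lambda>t. \<phi>(x := t)) -` (- K)" using assms(3) by simp
  ultimately have "eventually (\<lambda>t. t \<in> (\<lambda>t. \<phi>(x := t)) -` (- K)) (nhds (\<phi> x))"
    by (rule eventually_nhds_in_open)
  then have "eventually (\<lambda>t. f (\<phi>(x := t)) = 0) (nhds (\<phi> x))"
    by (rule eventually_mono) (use assms configs_upd[of \<phi> n x] in auto)
  then have "((\<lambda>t. f (\<phi>(x := t))) has_real_derivative 0) (at (\<phi> x))"
    by (subst DERIV_cong_ev[OF refl _ refl, where g = "\<lambda>_. 0"]) auto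
  then show ?thesis by (rule pd_eqI)
qed

section \<open>Gaussian integration by parts\<close>

abbreviation gaussian :: "real \<Rightarrow> real measure" where
  "gaussian m \<equiv> density lborel (\<lambda>t. ennreal (normal_density m 1 t))"

definition gaussian_field :: "nat \<Rightarrow> (nat \<Rightarrow> real) \<Rightarrow> (nat \<Rightarrow> real) measure" where
  "gaussian_field n m = (\<Pi>\<^sub>M x\<in>sites n. gaussian (m x))"

lemma space_gaussian_field: "space (gaussian_field n m) = configs n"
  by (simp add: gaussian_field_def space_PiM configs_def)

lemma gaussian_product: "product_prob_space (\<lambda>x. gaussian (m x))"
  by (intro product_prob_spaceI prob_space_normal_density) simp

lemma prob_space_gaussian_field: "prob_space (gaussian_field n m)"
proof -
  interpret product_prob_space "\<lambda>x. gaussian (m x)" by (rule gaussian_product)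
  show ?thesis unfolding gaussian_field_def by (rule prob_space_PiM) (rule prob_space_normal_density, simp)
qed

text \<open>The product measure lives on the finite product sigma-algebra, while continuity refers to
  the topology of all functions on \<^typ>\<open>nat\<close>. The bridge is that the Borel sets of the countable
  power are generated by the coordinates, and that the coordinates off \<open>sites n\<close> are constant.\<close>

lemma measurable_gaussian_field:
  fixes u :: "(nat \<Rightarrow> real) \<Rightarrow> real"
  assumes "continuous_on (configs n) u"
  shows "u \<in> borel_measurable (gaussian_field n m)"
proof -
  have "(\<lambda>\<phi>. \<phi>) \<in> gaussian_field n m \<rightarrow>\<^sub>M Pi\<^sub>M UNIV (\<lambda>_. borel :: real measure)"
  proof (rule measurable_PiM_single')
    fix i :: nat
    show "(\<lambda>\<phi>. \<phi> i) \<in> gaussian_field n m \<rightarrow>\<^sub>M borel"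
    proof (cases "i \<in> sites n")
      case True
      then show ?thesis unfolding gaussian_field_def
        using measurable_component_singleton[of i "sites n" "\<lambda>x. gaussian (m x)"] by simp
    next
      case False
      then have "\<phi> i = undefined" if "\<phi> \<in> space (gaussian_field n m)" for \<phi>
        using that unfolding space_gaussian_field configs_def by (auto simp: PiE_iff extensional_def)
      then show ?thesis
        by (subst measurable_cong[where g = "\<lambda>_. undefined"]) auto
    qed
  qed auto
  then have "(\<lambda>\<phi>. \<phi>) \<in> gaussian_field n m \<rightarrow>\<^sub>M restrict_space borel (configs n)"
    by (intro measurable_restrict_space2)
      (auto simp: space_gaussian_field cong: measurable_cong_sets[OF refl sets_PiM_equal_borel])
  from measurable_compose[OF this borel_measurable_continuous_on_restrict[OF assms]]
  show ?thesis .
qed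

lemma integrable_gaussian_field:
  fixes u :: "(nat \<Rightarrow> real) \<Rightarrow> real"
  assumes u: "continuous_on (configs n) u" and K: "compact K" "K \<subseteq> configs n"
    and z: "\<And>\<phi>. \<phi> \<in> configs n - K \<Longrightarrow> u \<phi> = 0"
  shows "integrable (gaussian_field n m) u"
proof -
  interpret prob_space "gaussian_field n m" by (rule prob_space_gaussian_field)
  have "compact (u ` K)"
    using compact_continuous_image[OF continuous_on_subset[OF u K(2)] K(1)] .
  then have "bounded (u ` K)" by (rule compact_imp_bounded)
  then obtain B where "\<forall>y\<in>u ` K. norm y \<le> B" unfolding bounded_iff by blast
  then have B: "norm (u \<phi>) \<le> B" if "\<phi> \<in> K" for \<phi> using that by simp
  have "norm (u \<phi>) \<le> max B 0" if "\<phi> \<in> configs n" for \<phi>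
    using that B[of \<phi>] z[of \<phi>] by (cases "\<phi> \<in> K") auto
  then have "AE \<phi> in gaussian_field n m. norm (u \<phi>) \<le> max B 0"
    by (intro AE_I2) (simp add: space_gaussian_field)
  then show ?thesis
    using measurable_gaussian_field[OF u] by (rule integrable_const_bound)
qed

text \<open>The integrand times the Gaussian density is the derivative of \<open>h\<close> times the density, and
  \<open>h\<close> vanishes at both ends of a long interval. Keeping the two terms under one integral avoids
  integrability side conditions.\<close>

lemma stein_1d:
  assumes h: "\<And>t. (h has_real_derivative h' t) (at t)" and c: "continuous_on UNIV h'"
    and z: "\<And>t. \<bar>t\<bar> \<ge> R \<Longrightarrow> h t = 0 \<and> h' t = 0"
  shows "(\<integral>t. (h' t - (t - m) * h t) \<partial>gaussian m) = 0"
proof -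
  define R' where "R' = \<bar>R\<bar>"
  let ?r = "normal_density m 1"
  let ?F = "\<lambda>t. h t * ?r t" and ?f = "\<lambda>t. (h' t - (t - m) * h t) * ?r t"
  have r: "(?r has_real_derivative - (t - m) * ?r t) (at t)" for t
  proof -
    have "((\<lambda>t. c * exp (- (t - m)\<^sup>2 / 2)) has_real_derivative
        - (t - m) * (c * exp (- (t - m)\<^sup>2 / 2))) (at t)" for c :: real
      by (auto intro!: derivative_eq_intros simp: field_simps)
    from this[of "1 / sqrt (2 * pi)"] show ?thesis unfolding normal_density_def by simp
  qed
  have F: "(?F has_real_derivative ?f t) (at t)" for t
    by (rule DERIV_mult[OF h r, THEN DERIV_cong]) (simp add: algebra_simps)
  have hc: "continuous_on UNIV h" using h by (meson DERIV_isCont continuous_at_imp_continuous_on)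
  have rc: "continuous_on UNIV ?r" using r by (meson DERIV_isCont continuous_at_imp_continuous_on)
  have "continuous_on UNIV ?f"
    by (intro continuous_on_mult continuous_on_diff continuous_on_id continuous_on_const hc rc c)
  then have "continuous_on {- R'..R'} ?f" by (rule continuous_on_subset) simp
  then have "(\<integral>t. indicator {- R'..R'} t *\<^sub>R ?f t \<partial>lborel) = ?F R' - ?F (- R')"
    using has_field_derivative_at_within[OF F]
    by (intro integral_FTC_Icc)
      (simp_all add: R'_def has_real_derivative_iff_has_vector_derivative[symmetric])
  also have "\<dots> = 0" using z[of R'] z[of "- R'"] by (simp add: R'_def)
  also have "(\<lambda>t. indicator {- R'..R'} t *\<^sub>R ?f t) = ?f"
    using z by (auto simp: fun_eq_iff R'_def split: split_indicator)
  finally have 0: "(\<integral>t. ?f t \<partial>lborel) = 0" .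
  have "(\<lambda>t. h' t - (t - m) * h t) \<in> borel_measurable borel"
    by (intro borel_measurable_continuous_onI continuous_on_mult continuous_on_diff
        continuous_on_id continuous_on_const hc c)
  then have "(\<integral>t. (h' t - (t - m) * h t) \<partial>gaussian m) = (\<integral>t. ?r t *\<^sub>R (h' t - (t - m) * h t) \<partial>lborel)"
    by (subst integral_density) auto
  also have "\<dots> = 0" using 0 by (simp add: mult.commute)
  finally show ?thesis .
qed

text \<open>Fubini reduces the claim to the lines in direction \<open>x\<close>. Since \<open>K\<close> is compact, its
  coordinate \<open>x\<close> is bounded, so \<open>h\<close> restricted to any such line has bounded support.\<close>

lemma stein_field:
  assumes h: "C_class 1 n h" and K: "compact K" "K \<subseteq> configs n"
    and z: "\<And>\<phi>. \<phi> \<in> configs n - K \<Longrightarrow> h \<phi> = 0" and x: "x \<in> sites n"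
  shows "(\<integral>\<phi>. (pd x h \<phi> - (\<phi> x - m x) * h \<phi>) \<partial>gaussian_field n m) = 0"
proof -
  interpret product_prob_space "\<lambda>x. gaussian (m x)" by (rule gaussian_product)
  let ?g = "\<lambda>\<phi>. pd x h \<phi> - (\<phi> x - m x) * h \<phi>"
  have hc: "continuous_on (configs n) h" using h by (rule C_class_cont)
  have pc: "continuous_on (configs n) (pd x h)" using h x by simp
  have pz: "pd x h \<phi> = 0" if "\<phi> \<in> configs n - K" for \<phi>
    using compact_imp_closed[OF K(1)] z that x by (rule pd_outside[where f = h and n = n])
  have "compact ((\<lambda>\<phi>. \<phi> x) ` K)"
    by (rule compact_continuous_image[OF continuous_on_coord K(1)])
  then have "bounded ((\<lambda>\<phi>. \<phi> x) ` K)" by (rule compact_imp_bounded)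
  then obtain R where "\<forall>y\<in>(\<lambda>\<phi>. \<phi> x) ` K. norm y \<le> R" unfolding bounded_iff by blast
  then have R: "\<bar>\<phi> x\<bar> \<le> R" if "\<phi> \<in> K" for \<phi> using that by simp
  have int: "integrable (gaussian_field n m) ?g"
  proof (rule integrable_gaussian_field[OF _ K])
    show "continuous_on (configs n) ?g"
      by (intro continuous_on_mult continuous_on_diff continuous_on_coord continuous_on_const pc hc)
  qed (simp add: z pz)
  have ins: "insert x (sites n - {x}) = sites n" using x by auto
  have "(\<integral>\<phi>. ?g \<phi> \<partial>gaussian_field n m)
      = (\<integral>\<phi>. (\<integral>t. ?g (\<phi>(x := t)) \<partial>gaussian (m x)) \<partial>Pi\<^sub>M (sites n - {x}) (\<lambda>x. gaussian (m x)))"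
    using product_integral_insert[of "sites n - {x}" x ?g, unfolded ins] int
    unfolding gaussian_field_def by simp
  also have "\<dots> = (\<integral>\<phi>. 0 \<partial>Pi\<^sub>M (sites n - {x}) (\<lambda>x. gaussian (m x)))"
  proof (rule Bochner_Integration.integral_cong[OF refl])
    fix \<phi> assume "\<phi> \<in> space (Pi\<^sub>M (sites n - {x}) (\<lambda>x. gaussian (m x)))"
    then have up: "\<phi>(x := t) \<in> configs n" for t
      using x unfolding configs_def space_PiM by (auto simp: PiE_iff extensional_def)
    have out: "\<phi>(x := t) \<in> configs n - K" if "\<bar>t\<bar> \<ge> R + 1" for t
      using R[of "\<phi>(x := t)"] that up by auto
    have "(\<integral>t. (pd x h (\<phi>(x := t)) - (t - m x) * h (\<phi>(x := t))) \<partial>gaussian (m x)) = 0"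
    proof (rule stein_1d)
      show "((\<lambda>t. h (\<phi>(x := t))) has_real_derivative pd x h (\<phi>(x := t))) (at t)" for t
        using C1_deriv[of 0 n h "\<phi>(x := 0)" x t] h up x by simp
      show "continuous_on UNIV (\<lambda>t. pd x h (\<phi>(x := t)))"
        using continuous_on_line[OF pc up[of 0] x] by simp
      show "h (\<phi>(x := t)) = 0 \<and> pd x h (\<phi>(x := t)) = 0" if "\<bar>t\<bar> \<ge> R + 1" for t
        using z[OF out[OF that]] pz[OF out[OF that]] by simp
    qed
    then show "(\<integral>t. ?g (\<phi>(x := t)) \<partial>gaussian (m x)) = 0" by simp
  qed
  finally show ?thesis by simp
qed

text \<open>The formal adjoint of \<open>pd x\<close> in \<open>L\<^sup>2\<close> of \<open>gaussian_field n m\<close>, a creation operator.\<close>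

definition pd_adj :: "(nat \<Rightarrow> real) \<Rightarrow> nat \<Rightarrow> ((nat \<Rightarrow> real) \<Rightarrow> real) \<Rightarrow> (nat \<Rightarrow> real) \<Rightarrow> real" where
  "pd_adj m x u \<phi> = (\<phi> x - m x) * u \<phi> - pd x u \<phi>"

text \<open>Stein's identity for the product \<open>f u\<close>. The support of \<open>f\<close> alone gives integrability, since
  every term contains \<open>f\<close> or one of its derivatives; \<open>u\<close> may grow.\<close>

lemma gaussian_by_parts:
  assumes f: "C_class 1 n f" and u: "C_class 1 n u" and K: "compact K" "K \<subseteq> configs n"
    and z: "\<And>\<phi>. \<phi> \<in> configs n - K \<Longrightarrow> f \<phi> = 0" and x: "x \<in> sites n"
  shows "(\<integral>\<phi>. f \<phi> * pd_adj m x u \<phi> \<partial>gaussian_field n m) = (\<integral>\<phi>. pd x f \<phi> * u \<phi> \<partial>gaussian_field n m)"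
    and "integrable (gaussian_field n m) (\<lambda>\<phi>. f \<phi> * pd_adj m x u \<phi>)"
    and "integrable (gaussian_field n m) (\<lambda>\<phi>. pd x f \<phi> * u \<phi>)"
proof -
  have c: "continuous_on (configs n) f" "continuous_on (configs n) u"
    "continuous_on (configs n) (pd x f)" "continuous_on (configs n) (pd x u)"
    using f u x by simp_all
  have pz: "pd x f \<phi> = 0" if "\<phi> \<in> configs n - K" for \<phi>
    using compact_imp_closed[OF K(1)] z that x by (rule pd_outside[where f = f and n = n])
  show i1: "integrable (gaussian_field n m) (\<lambda>\<phi>. f \<phi> * pd_adj m x u \<phi>)"
  proof (rule integrable_gaussian_field[OF _ K])
    show "continuous_on (configs n) (\<lambda>\<phi>. f \<phi> * pd_adj m x u \<phi>)"
      unfolding pd_adj_def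
      by (intro continuous_on_mult continuous_on_diff continuous_on_coord continuous_on_const c)
  qed (simp add: z)
  show i2: "integrable (gaussian_field n m) (\<lambda>\<phi>. pd x f \<phi> * u \<phi>)"
    by (rule integrable_gaussian_field[OF continuous_on_mult[OF c(3,2)] K]) (simp add: pz)
  have "(\<integral>\<phi>. pd x f \<phi> * u \<phi> - f \<phi> * pd_adj m x u \<phi> \<partial>gaussian_field n m)
      = (\<integral>\<phi>. pd x (\<lambda>\<phi>. f \<phi> * u \<phi>) \<phi> - (\<phi> x - m x) * (f \<phi> * u \<phi>) \<partial>gaussian_field n m)"
  proof (rule Bochner_Integration.integral_cong[OF refl])
    fix \<phi> assume "\<phi> \<in> space (gaussian_field n m)"
    then have prod: "pd x (\<lambda>\<phi>. f \<phi> * u \<phi>) \<phi> = pd x f \<phi> * u \<phi> + pd x u \<phi> * f \<phi>"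
      by (intro pd_mult[OF f u _ x]) (simp add: space_gaussian_field)
    show "pd x f \<phi> * u \<phi> - f \<phi> * pd_adj m x u \<phi>
        = pd x (\<lambda>\<phi>. f \<phi> * u \<phi>) \<phi> - (\<phi> x - m x) * (f \<phi> * u \<phi>)"
      unfolding pd_adj_def prod by (simp add: algebra_simps)
  qed
  also have "\<dots> = 0"
    by (rule stein_field[OF C1_mult[OF f u] K _ x]) (simp add: z)
  finally show "(\<integral>\<phi>. f \<phi> * pd_adj m x u \<phi> \<partial>gaussian_field n m) = (\<integral>\<phi>. pd x f \<phi> * u \<phi> \<partial>gaussian_field n m)"
    using Bochner_Integration.integral_diff[OF i2 i1] by linarith
qed

section \<open>Reversibility and the sector condition\<close>

definition carre_du_champ ::
  "real \<Rightarrow> nat \<Rightarrow> ((nat \<Rightarrow> real) \<Rightarrow> real) \<Rightarrow> ((nat \<Rightarrow> real) \<Rightarrow> real) \<Rightarrow> (nat \<Rightarrow> real) \<Rightarrow> real" where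
  "carre_du_champ \<gamma> n f g \<phi> = real n powr \<gamma> *
     (pd 1 f \<phi> * pd 1 g \<phi> + pd (n - 1) f \<phi> * pd (n - 1) g \<phi>
      + 1 / 2 * (\<Sum>x\<in>sites n. \<Sum>y\<in>sites n.
          jump \<gamma> (int y - int x) * (pdiff x y f \<phi> * pdiff x y g \<phi>)))"

text \<open>An algebraic identity, valid for any function \<open>g\<close>: only the coefficients of the first and
  second order terms are regrouped. The profile equation is what makes the first-order
  remainders of bonds and reservoirs cancel.\<close>

lemma gen_eq_adjoint_form:
  assumes n: "n \<ge> 2" and m: "is_profile \<gamma> \<Phi>l \<Phi>r n m"
  shows "- gen \<gamma> \<Phi>l \<Phi>r n g \<phi> = real n powr \<gamma> *
     (pd_adj m 1 (pd 1 g) \<phi> + pd_adj m (n - 1) (pd (n - 1) g) \<phi>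
      + 1 / 2 * (\<Sum>x\<in>sites n. \<Sum>y\<in>sites n. jump \<gamma> (int y - int x) *
          (pd_adj m y (pdiff x y g) \<phi> - pd_adj m x (pdiff x y g) \<phi>)))"
proof -
  let ?J = "\<lambda>x y. jump \<gamma> (int y - int x)"
  let ?v = "\<lambda>x. pd x g \<phi>"
  let ?S = "\<Sum>x\<in>sites n. \<Sum>y\<in>sites n. ?J x y *
    (pd_adj m y (pdiff x y g) \<phi> - pd_adj m x (pdiff x y g) \<phi>)"
  have mem: "1 \<in> sites n" "n - 1 \<in> sites n" using n by (auto simp: sites_def)
  have res: "gen_res \<Phi> x g \<phi> = (\<Phi> - m x) * ?v x - pd_adj m x (pd x g) \<phi>" for \<Phi> x
    by (simp add: gen_res_def pd_adj_def algebra_simps)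
  have "?J x y * ((\<phi> x - \<phi> y) * pdiff x y g \<phi> + pdiff x y (pdiff x y g) \<phi>)
      = - (?J x y * (pd_adj m y (pdiff x y g) \<phi> - pd_adj m x (pdiff x y g) \<phi>))
        - ?J x y * ((m y - m x) * (?v y - ?v x))" for x y
  proof -
    have X: "?v y - ?v x = pdiff x y g \<phi>" by (rule pdiff_def[symmetric])
    have XX: "pdiff x y (pdiff x y g) \<phi> = pd y (pdiff x y g) \<phi> - pd x (pdiff x y g) \<phi>"
      by (rule pdiff_def)
    show ?thesis unfolding pd_adj_def X XX by (simp add: algebra_simps)
  qed
  then have bulk: "gen_bulk \<gamma> n g \<phi>
      = - 1 / 2 * ?S - 1 / 2 * (\<Sum>x\<in>sites n. \<Sum>y\<in>sites n. ?J x y * ((m y - m x) * (?v y - ?v x)))"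
    unfolding gen_bulk_def by (simp add: sum_subtractf sum_negf)
  \<comment> \<open>the drift of the bonds, moved to the sites, is minus the drift of the reservoirs\<close>
  have "(\<Sum>x\<in>sites n. \<Sum>y\<in>sites n. ?J x y * ((m y - m x) * (?v y - ?v x)))
      = - 2 * (\<Sum>x\<in>sites n. (\<Sum>y\<in>sites n. ?J x y * (m y - m x)) * ?v x)"
    by (rule symmetric_sum_by_parts) (rule jump_sym)
  also have "(\<Sum>x\<in>sites n. (\<Sum>y\<in>sites n. ?J x y * (m y - m x)) * ?v x)
      = (\<Sum>x\<in>sites n. (if x = 1 then - (\<Phi>l - m x) * ?v x else 0)
          + (if x = n - 1 then - (\<Phi>r - m x) * ?v x else 0))"
  proof (rule sum.cong[OF refl])
    fix x assume "x \<in> sites n"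
    then have "(\<Sum>y\<in>sites n. ?J x y * (m y - m x))
        = (if x = 1 then - (\<Phi>l - m x) else 0) + (if x = n - 1 then - (\<Phi>r - m x) else 0)"
      using m unfolding is_profile_def by (force simp: algebra_simps split: if_splits)
    then show "(\<Sum>y\<in>sites n. ?J x y * (m y - m x)) * ?v x
      = (if x = 1 then - (\<Phi>l - m x) * ?v x else 0) + (if x = n - 1 then - (\<Phi>r - m x) * ?v x else 0)"
      by (simp add: algebra_simps)
  qed
  also have "\<dots> = - ((\<Phi>l - m 1) * ?v 1 + (\<Phi>r - m (n - 1)) * ?v (n - 1))"
    using mem by (simp add: sum.distrib algebra_simps)
  finally have drift: "(\<Sum>x\<in>sites n. \<Sum>y\<in>sites n. ?J x y * ((m y - m x) * (?v y - ?v x)))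
      = 2 * ((\<Phi>l - m 1) * ?v 1 + (\<Phi>r - m (n - 1)) * ?v (n - 1))" by simp
  have sum: "gen_res \<Phi>l 1 g \<phi> + gen_res \<Phi>r (n - 1) g \<phi> + gen_bulk \<gamma> n g \<phi>
      = - (pd_adj m 1 (pd 1 g) \<phi> + pd_adj m (n - 1) (pd (n - 1) g) \<phi> + 1 / 2 * ?S)"
    unfolding res bulk drift by (simp add: add_divide_distrib)
  show ?thesis unfolding gen_def sum by (simp only: mult_minus_right minus_minus)
qed

text \<open>The two integrals are computed term by term from \<open>gaussian_by_parts\<close> and give literally the
  same finite sum. Stating this with a common value \<open>I\<close> also delivers integrability of the carre
  du champ.\<close>

lemma has_dirichlet_form:
  assumes n: "n \<ge> 2" and m: "is_profile \<gamma> \<Phi>l \<Phi>r n m"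
    and f: "C_class 1 n f" and g: "C_class (Suc 1) n g"
    and K: "compact K" "K \<subseteq> configs n" and z: "\<And>\<phi>. \<phi> \<in> configs n - K \<Longrightarrow> f \<phi> = 0"
  shows "\<exists>I. has_bochner_integral (gaussian_field n m) (\<lambda>\<phi>. f \<phi> * - gen \<gamma> \<Phi>l \<Phi>r n g \<phi>) I
    \<and> has_bochner_integral (gaussian_field n m) (carre_du_champ \<gamma> n f g) I"
proof -
  let ?M = "gaussian_field n m"
  let ?J = "\<lambda>x y. jump \<gamma> (int y - int x)"
  define I where "I x u = (\<integral>\<phi>. pd x f \<phi> * u \<phi> \<partial>?M)" for x u
  have mem: "1 \<in> sites n" "n - 1 \<in> sites n" using n by (auto simp: sites_def)
  have I: "has_bochner_integral ?M (\<lambda>\<phi>. f \<phi> * pd_adj m x u \<phi>) (I x u)"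
    "has_bochner_integral ?M (\<lambda>\<phi>. pd x f \<phi> * u \<phi>) (I x u)"
    if "C_class 1 n u" "x \<in> sites n" for x u
  proof -
    note parts = gaussian_by_parts[where f = f and K = K, OF f that(1) K _ that(2)]
    show "has_bochner_integral ?M (\<lambda>\<phi>. f \<phi> * pd_adj m x u \<phi>) (I x u)"
      unfolding has_bochner_integral_iff I_def using z by (intro conjI parts)
    show "has_bochner_integral ?M (\<lambda>\<phi>. pd x f \<phi> * u \<phi>) (I x u)"
      unfolding has_bochner_integral_iff I_def using z by (intro conjI parts refl)
  qed
  have pd: "C_class 1 n (pd x g)" if "x \<in> sites n" for x
    using C_class_pd[OF g that] .
  have pdiff: "C_class 1 n (pdiff x y g)" if "x \<in> sites n" "y \<in> sites n" for x y
    using C1_diff[OF pd[OF that(2)] pd[OF that(1)]] unfolding pdiff_def[abs_def] .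
  let ?I = "real n powr \<gamma> * (I 1 (pd 1 g) + I (n - 1) (pd (n - 1) g)
    + 1 / 2 * (\<Sum>x\<in>sites n. \<Sum>y\<in>sites n. ?J x y * (I y (pdiff x y g) - I x (pdiff x y g))))"
  have "has_bochner_integral ?M (\<lambda>\<phi>. real n powr \<gamma> *
     (f \<phi> * pd_adj m 1 (pd 1 g) \<phi> + f \<phi> * pd_adj m (n - 1) (pd (n - 1) g) \<phi>
      + 1 / 2 * (\<Sum>x\<in>sites n. \<Sum>y\<in>sites n. ?J x y *
          (f \<phi> * pd_adj m y (pdiff x y g) \<phi> - f \<phi> * pd_adj m x (pdiff x y g) \<phi>)))) ?I"
    by (intro has_bochner_integral_mult_right has_bochner_integral_add has_bochner_integral_sum
      has_bochner_integral_diff I pd pdiff mem)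
  also have "(\<lambda>\<phi>. real n powr \<gamma> *
     (f \<phi> * pd_adj m 1 (pd 1 g) \<phi> + f \<phi> * pd_adj m (n - 1) (pd (n - 1) g) \<phi>
      + 1 / 2 * (\<Sum>x\<in>sites n. \<Sum>y\<in>sites n. ?J x y *
          (f \<phi> * pd_adj m y (pdiff x y g) \<phi> - f \<phi> * pd_adj m x (pdiff x y g) \<phi>))))
    = (\<lambda>\<phi>. f \<phi> * - gen \<gamma> \<Phi>l \<Phi>r n g \<phi>)"
    unfolding gen_eq_adjoint_form[OF n m]
    by (simp add: fun_eq_iff sum_distrib_left algebra_simps)
  finally have 1: "has_bochner_integral ?M (\<lambda>\<phi>. f \<phi> * - gen \<gamma> \<Phi>l \<Phi>r n g \<phi>) ?I" .
  have "has_bochner_integral ?M (\<lambda>\<phi>. real n powr \<gamma> *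
     (pd 1 f \<phi> * pd 1 g \<phi> + pd (n - 1) f \<phi> * pd (n - 1) g \<phi>
      + 1 / 2 * (\<Sum>x\<in>sites n. \<Sum>y\<in>sites n. ?J x y *
          (pd y f \<phi> * pdiff x y g \<phi> - pd x f \<phi> * pdiff x y g \<phi>)))) ?I"
    by (intro has_bochner_integral_mult_right has_bochner_integral_add has_bochner_integral_sum
      has_bochner_integral_diff I pd pdiff mem)
  then have 2: "has_bochner_integral ?M (carre_du_champ \<gamma> n f g) ?I"
    unfolding carre_du_champ_def[abs_def] by (simp only: pdiff_def[of _ _ f] left_diff_distrib)
  from 1 2 show ?thesis by blast
qed

text \<open>For smooth functions the expression is \<open>\<Gamma>(t f + g, t f + g)\<close>, expanded by bilinearity; written out, it is a sum of
  squares with nonnegative weights.\<close>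

lemma carre_du_champ_quadratic_nonneg:
  assumes "\<gamma> > 0"
  shows "0 \<le> t\<^sup>2 * carre_du_champ \<gamma> n f f \<phi> + 2 * t * carre_du_champ \<gamma> n f g \<phi> + carre_du_champ \<gamma> n g g \<phi>"
proof -
  let ?J = "\<lambda>x y. jump \<gamma> (int y - int x)"
  let ?q = "\<lambda>a b. (t * a + b) * (t * a + b) :: real"
  have sq: "t\<^sup>2 * (a * a) + 2 * t * (a * b) + b * b = ?q a b" for a b
    by (simp add: algebra_simps power2_eq_square)
  have sum_sq: "t\<^sup>2 * (\<Sum>x\<in>sites n. \<Sum>y\<in>sites n. ?J x y * (a x y * a x y))
      + 2 * t * (\<Sum>x\<in>sites n. \<Sum>y\<in>sites n. ?J x y * (a x y * b x y))
      + (\<Sum>x\<in>sites n. \<Sum>y\<in>sites n. ?J x y * (b x y * b x y))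
      = (\<Sum>x\<in>sites n. \<Sum>y\<in>sites n. ?J x y * ?q (a x y) (b x y))" for a b
    unfolding sum_distrib_left sum.distrib[symmetric] sq[symmetric]
    by (intro sum.cong refl) (simp only: algebra_simps)
  have lin: "t\<^sup>2 * (c * (a + a' + r * a'')) + 2 * t * (c * (b + b' + r * b'')) + c * (d + d' + r * d'')
      = c * ((t\<^sup>2 * a + 2 * t * b + d) + (t\<^sup>2 * a' + 2 * t * b' + d') + r * (t\<^sup>2 * a'' + 2 * t * b'' + d''))"
    for c r a a' a'' b b' b'' d d' d'' :: real
    by (simp add: algebra_simps)
  have "t\<^sup>2 * carre_du_champ \<gamma> n f f \<phi> + 2 * t * carre_du_champ \<gamma> n f g \<phi> + carre_du_champ \<gamma> n g g \<phi>
      = real n powr \<gamma> * (?q (pd 1 f \<phi>) (pd 1 g \<phi>) + ?q (pd (n - 1) f \<phi>) (pd (n - 1) g \<phi>)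
       + 1 / 2 * (\<Sum>x\<in>sites n. \<Sum>y\<in>sites n. ?J x y * ?q (pdiff x y f \<phi>) (pdiff x y g \<phi>)))"
    unfolding carre_du_champ_def sum_sq[symmetric] unfolding sq[symmetric] by (rule lin)
  also have "\<dots> \<ge> 0"
    using jump_nonneg[OF assms]
    by (intro mult_nonneg_nonneg add_nonneg_nonneg sum_nonneg zero_le_square) auto
  finally show ?thesis .
qed

text \<open>The standard step from a nonnegative quadratic form to Cauchy-Schwarz, including the
  degenerate case of a vanishing leading coefficient.\<close>

lemma discriminant_le:
  fixes a b c :: real
  assumes "a \<ge> 0" and q: "\<And>t. 0 \<le> t\<^sup>2 * a + 2 * t * b + c"
  shows "b\<^sup>2 \<le> a * c"
proof (cases "a = 0")
  case True
  have "b = 0"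
  proof (rule ccontr)
    assume "b \<noteq> 0"
    then show False using q[of "- (c + 1) / (2 * b)"] True by (simp add: field_simps)
  qed
  with True show ?thesis by simp
next
  case False
  then have "0 \<le> a * ((- b / a)\<^sup>2 * a + 2 * (- b / a) * b + c)"
    using assms(1) q[of "- b / a"] by (intro mult_nonneg_nonneg) auto
  also have "\<dots> = a * c - b\<^sup>2" using False by (simp add: field_simps power2_eq_square)
  finally show ?thesis by simp
qed

lemma compact_supp_obtain:
  assumes "compact_supp n f"
  obtains K where "compact K" "K \<subseteq> configs n" "\<And>\<phi>. \<phi> \<in> configs n - K \<Longrightarrow> f \<phi> = 0"
proof
  let ?K = "closure {\<phi> \<in> configs n. f \<phi> \<noteq> 0}"
  show "compact ?K" using assms unfolding compact_supp_def .
  show "?K \<subseteq> configs n" by (intro closure_minimal closed_configs) auto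
  show "f \<phi> = 0" if "\<phi> \<in> configs n - ?K" for \<phi>
    using that closure_subset[of "{\<phi> \<in> configs n. f \<phi> \<noteq> 0}"] by blast
qed

lemma dirichlet_form:
  assumes "\<gamma> > 0" "n \<ge> 2" "smooth_fun n f" "compact_supp n f" "smooth_fun n g"
  shows "integrable (\<mu>ss \<gamma> \<Phi>l \<Phi>r n) (carre_du_champ \<gamma> n f g)"
    and "L2_inner (\<mu>ss \<gamma> \<Phi>l \<Phi>r n) f (\<lambda>\<phi>. - gen \<gamma> \<Phi>l \<Phi>r n g \<phi>)
      = (\<integral>\<phi>. carre_du_champ \<gamma> n f g \<phi> \<partial>\<mu>ss \<gamma> \<Phi>l \<Phi>r n)"
proof -
  obtain K where K: "compact K" "K \<subseteq> configs n" "\<And>\<phi>. \<phi> \<in> configs n - K \<Longrightarrow> f \<phi> = 0"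
    using compact_supp_obtain[OF assms(4)] by metis
  have M: "\<mu>ss \<gamma> \<Phi>l \<Phi>r n = gaussian_field n (profile \<gamma> \<Phi>l \<Phi>r n)"
    unfolding \<mu>ss_def gaussian_field_def ..
  have "C_class 1 n f" "C_class (Suc 1) n g"
    using assms(3,5) unfolding smooth_fun_def by blast+
  note * = has_dirichlet_form[where f = f and K = K,
      OF assms(2) profile_is_profile[OF assms(1,2)] this K(1,2)]
  obtain I where "has_bochner_integral (\<mu>ss \<gamma> \<Phi>l \<Phi>r n) (\<lambda>\<phi>. f \<phi> * - gen \<gamma> \<Phi>l \<Phi>r n g \<phi>) I"
    "has_bochner_integral (\<mu>ss \<gamma> \<Phi>l \<Phi>r n) (carre_du_champ \<gamma> n f g) I"
    unfolding M using * K(3) by blast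
  then show "integrable (\<mu>ss \<gamma> \<Phi>l \<Phi>r n) (carre_du_champ \<gamma> n f g)"
    and "L2_inner (\<mu>ss \<gamma> \<Phi>l \<Phi>r n) f (\<lambda>\<phi>. - gen \<gamma> \<Phi>l \<Phi>r n g \<phi>)
      = (\<integral>\<phi>. carre_du_champ \<gamma> n f g \<phi> \<partial>\<mu>ss \<gamma> \<Phi>l \<Phi>r n)"
    unfolding L2_inner_def has_bochner_integral_iff by simp_all
qed

lemma sector_condition:
  assumes "\<gamma> > 0" "n \<ge> 2"
    and f: "smooth_fun n f" "compact_supp n f" and g: "smooth_fun n g" "compact_supp n g"
  shows "(L2_inner (\<mu>ss \<gamma> \<Phi>l \<Phi>r n) f (\<lambda>\<phi>. - gen \<gamma> \<Phi>l \<Phi>r n g \<phi>))\<^sup>2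
        \<le> L2_inner (\<mu>ss \<gamma> \<Phi>l \<Phi>r n) f (\<lambda>\<phi>. - gen \<gamma> \<Phi>l \<Phi>r n f \<phi>)
          * L2_inner (\<mu>ss \<gamma> \<Phi>l \<Phi>r n) g (\<lambda>\<phi>. - gen \<gamma> \<Phi>l \<Phi>r n g \<phi>)"
proof -
  let ?M = "\<mu>ss \<gamma> \<Phi>l \<Phi>r n" and ?\<Gamma> = "carre_du_champ \<gamma> n"
  note D = dirichlet_form[OF assms(1,2), where \<Phi>l = \<Phi>l and \<Phi>r = \<Phi>r]
  have i: "integrable ?M (?\<Gamma> f f)" "integrable ?M (?\<Gamma> f g)" "integrable ?M (?\<Gamma> g g)"
    using D(1) f g by blast+
  have "(\<integral>\<phi>. ?\<Gamma> f g \<phi> \<partial>?M)\<^sup>2 \<le> (\<integral>\<phi>. ?\<Gamma> f f \<phi> \<partial>?M) * (\<integral>\<phi>. ?\<Gamma> g g \<phi> \<partial>?M)"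
  proof (rule discriminant_le)
    show "0 \<le> (\<integral>\<phi>. ?\<Gamma> f f \<phi> \<partial>?M)"
    proof (rule Bochner_Integration.integral_nonneg)
      show "0 \<le> ?\<Gamma> f f \<phi>" for \<phi>
        using carre_du_champ_quadratic_nonneg[OF assms(1), of 0 n f \<phi> f] by simp
    qed
    fix t :: real
    have "0 \<le> (\<integral>\<phi>. t\<^sup>2 * ?\<Gamma> f f \<phi> + 2 * t * ?\<Gamma> f g \<phi> + ?\<Gamma> g g \<phi> \<partial>?M)"
      by (intro Bochner_Integration.integral_nonneg carre_du_champ_quadratic_nonneg assms(1))
    also have "\<dots> = t\<^sup>2 * (\<integral>\<phi>. ?\<Gamma> f f \<phi> \<partial>?M) + 2 * t * (\<integral>\<phi>. ?\<Gamma> f g \<phi> \<partial>?M) + (\<integral>\<phi>. ?\<Gamma> g g \<phi> \<partial>?M)"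
      using i by simp
    finally show "0 \<le> t\<^sup>2 * (\<integral>\<phi>. ?\<Gamma> f f \<phi> \<partial>?M) + 2 * t * (\<integral>\<phi>. ?\<Gamma> f g \<phi> \<partial>?M) + (\<integral>\<phi>. ?\<Gamma> g g \<phi> \<partial>?M)" .
  qed
  then show ?thesis using D(2) f g by simp
qed

theorem theoremD3:
  fixes \<gamma> \<Phi>l \<Phi>r :: real
  assumes "1 < \<gamma>" and "\<gamma> < 2"
  shows "\<exists>K :: nat \<Rightarrow> real.
    (\<exists>C \<theta> :: real. C > 0 \<and> \<theta> > 0 \<and> (\<forall>n\<ge>2. K n \<le> C * real n powr \<theta>)) \<and>
    (\<forall>n\<ge>2. \<forall>f g :: (nat \<Rightarrow> real) \<Rightarrow> real.
      smooth_fun n f \<longrightarrow> compact_supp n f \<longrightarrow> smooth_fun n g \<longrightarrow> compact_supp n g \<longrightarrow>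
      (L2_inner (\<mu>ss \<gamma> \<Phi>l \<Phi>r n) f (\<lambda>\<phi>. - gen \<gamma> \<Phi>l \<Phi>r n g \<phi>))\<^sup>2
        \<le> K n * L2_inner (\<mu>ss \<gamma> \<Phi>l \<Phi>r n) f (\<lambda>\<phi>. - gen \<gamma> \<Phi>l \<Phi>r n f \<phi>)
              * L2_inner (\<mu>ss \<gamma> \<Phi>l \<Phi>r n) g (\<lambda>\<phi>. - gen \<gamma> \<Phi>l \<Phi>r n g \<phi>))"
proof (intro exI conjI allI impI)
  show "(0::real) < 1" "(0::real) < 1" by simp_all
  show "(\<lambda>_. 1) n \<le> 1 * real n powr 1" if "n \<ge> 2" for n using that by simp
  show "(L2_inner (\<mu>ss \<gamma> \<Phi>l \<Phi>r n) f (\<lambda>\<phi>. - gen \<gamma> \<Phi>l \<Phi>r n g \<phi>))\<^sup>2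
        \<le> (\<lambda>_. 1) n * L2_inner (\<mu>ss \<gamma> \<Phi>l \<Phi>r n) f (\<lambda>\<phi>. - gen \<gamma> \<Phi>l \<Phi>r n f \<phi>)
              * L2_inner (\<mu>ss \<gamma> \<Phi>l \<Phi>r n) g (\<lambda>\<phi>. - gen \<gamma> \<Phi>l \<Phi>r n g \<phi>)"
    if "n \<ge> 2" "smooth_fun n f" "compact_supp n f" "smooth_fun n g" "compact_supp n g" for n f g
    using sector_condition[OF _ that] assms(1) by simp
qed

end
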